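(* There exist explicit connected simple undirected finite graphs $G_3,G_4$ satisfying the following. 1. $G_3$ is $12$-regular, $|V(G_3)|=34{,}992$, and $\operatorname{diam}(G_3)=5$. 2. $G_4$ is $16$-regular, $|V(G_4)|=147{,}456$, and $\operatorname{diam}(G_4)=5$.
   Context: All graphs are finite. A simple undirected graph has no loops and no multiple edges. A graph is $k$-regular if every vertex has exactly $k$ neighbors. The distance between two vertices is the minimum length (number of edges) of a path joining them, and $\operatorname{diam}(G)$ is the maximum distance over all pairs of vertices of $G$. *)

theory Defs
  imports "Graph_Theory.Graph_Theory"
begin

text \<open>
  A simple undirected finite graph is a \<^locale>\<open>pair_graph\<close>: a finite set of vertices together
  with a symmetric irreflexive set of ordered pairs, the edge joining \<open>u\<close> and \<open>v\<close> being
  represented by the two pairs \<open>(u, v)\<close> and \<open>(v, u)\<close>.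
\<close>

definition neighbors :: "'a pair_pre_digraph \<Rightarrow> 'a \<Rightarrow> 'a set" where
  "neighbors G v = {u \<in> pverts G. (v, u) \<in> parcs G}"

definition regular :: "'a pair_pre_digraph \<Rightarrow> nat \<Rightarrow> bool" where
  "regular G k \<longleftrightarrow> (\<forall>v \<in> pverts G. card (neighbors G v) = k)"

text \<open>
  The predicate \<open>apath u p v\<close> says that the list of arcs \<open>p\<close> is a path from \<open>u\<close> to \<open>v\<close> (no
  repeated vertices; \<open>p = []\<close> if \<open>u = v\<close>), so the length of \<open>p\<close> is its number of edges.
  The next two definitions are meaningful for a connected graph only: if no path joins \<open>u\<close>
  and \<open>v\<close>, then \<open>LEAST\<close> is unspecified.
\<close>

definition distance :: "'a pair_pre_digraph \<Rightarrow> 'a \<Rightarrow> 'a \<Rightarrow> nat" where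
  "distance G u v = (LEAST n. \<exists>p. pre_digraph.apath (with_proj G) u p v \<and> length p = n)"

definition diam :: "'a pair_pre_digraph \<Rightarrow> nat" where
  "diam G = Max {distance G u v | u v. u \<in> pverts G \<and> v \<in> pverts G}"

end

theory Submission
  imports Defs "HOL-Algebra.Group" "HOL-Library.Cardinality"
begin

text \<open>
  Both graphs have \<open>144 q ^ 5\<close> vertices and degree \<open>4 q\<close>, with \<open>q = 3\<close> and \<open>q = 4\<close>, and come from one
  construction over the field \<open>F\<close> with \<open>q\<close> elements. Take a \<open>4\<close>-regular base graph with \<open>144\<close> vertices
  and put a copy of \<open>F ^ 5\<close>, the fibre, above each vertex. Each arc \<open>a\<close> of the base graph carries an
  invertible matrix \<open>T\<close> and a nonzero vector \<open>d\<close>, and a vector \<open>x\<close> above its source is joined to the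
  \<open>q\<close> vectors \<open>T (x + t d)\<close> above its target, \<open>t \<in> F\<close>.

  A walk of length \<open>5\<close> in the base graph leaves five coefficients \<open>t\<close> free. If the five directions,
  transported to the end of the walk by the matrices, are linearly independent, then the walk
  leads from every vector above its start to every vector above its end. So the lift has diameter
  at most \<open>5\<close> if any two base vertices are joined by such a walk. It has diameter at least \<open>5\<close>
  because too few vertices lie closer to a given one: at most \<open>22621\<close> for degree \<open>12\<close>, and at most
  \<open>69905\<close> for degree \<open>16\<close>.

  It remains to exhibit the data. The base graph is a lift of a graph with three vertices by a
  group of order \<open>48\<close>, which acts on the whole construction, so only walks from three base
  vertices have to be examined. The matrices are monomial. A search over the walks with
  Gaussian elimination at their ends (\<open>walk_ends\<close>, \<open>eliminate\<close>) is run by rewriting; that it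
  proves what it should is \<open>eliminate_spans\<close> and \<open>walk_ends_links\<close>, and the lift is turned into a
  graph by \<open>nat_graph_of_relation\<close>.
\<close>

section \<open>Graphs with prescribed diameter from relations\<close>

lemma (in wf_digraph) apath_of_awalk:
  assumes "awalk u p v"
  obtains p' where "apath u p' v" "length p' \<le> length p"
proof -
  have "\<exists>p'. apath u p' v \<and> length p' \<le> length p" using assms
  proof (induct rule: awalk_to_apath_induct)
    case (path p)
    then show ?case by (auto simp: apath_def)
  next
    case (decomp p q r s)
    then have "length (q @ s) \<le> length p" by (auto elim!: awalk_cyc_decompE)
    then show ?case using decomp(4) le_trans by blast
  qed
  then show ?thesis using that by blast
qed

lemma awalk_of_relpow:
  assumes "R \<subseteq> W \<times> W" "(u, v) \<in> R ^^ k" "u \<in> W"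
  shows "\<exists>p. pre_digraph.awalk (with_proj \<lparr>pverts = W, parcs = R\<rparr>) u p v \<and> length p = k"
proof -
  let ?G = "\<lparr>pverts = W, parcs = R\<rparr>"
  interpret pair_wf_digraph ?G using assms(1) by unfold_locales auto
  show ?thesis using assms(2,3)
  proof (induction k arbitrary: u)
    case 0
    then show ?case by (auto intro!: exI[of _ "[]"] simp: awalk_Nil_iff)
  next
    case (Suc k)
    then obtain w where w: "(u, w) \<in> R" "(w, v) \<in> R ^^ k" by (meson relpow_Suc_D2)
    with assms(1) have "w \<in> W" by blast
    with Suc.IH w(2) obtain p where p: "awalk w p v" "length p = k" by blast
    have "awalk u ((u, w) # p) v" using p(1) w(1) by (simp add: awalk_Cons_iff)
    then show ?case using p(2) by (intro exI[of _ "(u, w) # p"]) auto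
  qed
qed

lemma relpow_of_awalk:
  assumes "R \<subseteq> W \<times> W" "pre_digraph.awalk (with_proj \<lparr>pverts = W, parcs = R\<rparr>) u p v"
  shows "(u, v) \<in> R ^^ length p"
proof -
  interpret pair_wf_digraph "\<lparr>pverts = W, parcs = R\<rparr>" using assms(1) by unfold_locales auto
  show ?thesis using assms(2)
  proof (induction p arbitrary: u)
    case Nil
    then show ?case by (simp add: awalk_Nil_iff)
  next
    case (Cons e p)
    then have "(u, snd e) \<in> R" "(snd e, v) \<in> R ^^ length p"
      by (auto simp: awalk_Cons_iff)
    then show ?case unfolding length_Cons by (rule relpow_Suc_I2)
  qed
qed

lemma card_sphere_le:
  assumes "finite W" "R \<subseteq> W \<times> W" "\<And>v. v \<in> W \<Longrightarrow> card (R `` {v}) = d"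
  shows "card ((R ^^ i) `` {u}) \<le> d ^ i"
proof (induction i)
  case (Suc i)
  let ?S = "(R ^^ i) `` {u}"
  have fin: "finite (R `` {w})" for w using assms(1,2) by (auto intro: finite_subset)
  have finS: "finite ?S"
  proof (cases i)
    case (Suc j)
    then have "?S \<subseteq> W" using assms(2) by auto
    then show ?thesis using assms(1) finite_subset by blast
  qed simp
  have d: "card (R `` {w}) \<le> d" for w
  proof (cases "w \<in> W")
    case False
    then have "R `` {w} = {}" using assms(2) by auto
    then show ?thesis by simp
  qed (simp add: assms(3))
  have "(R ^^ Suc i) `` {u} = (\<Union>w\<in>?S. R `` {w})" by auto
  also have "card \<dots> \<le> (\<Sum>w\<in>?S. card (R `` {w}))" using finS fin by (intro card_UN_le) auto
  also have "\<dots> \<le> card ?S * d" using sum_bounded_above[of ?S "\<lambda>w. card (R `` {w})" d] d by simp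
  also have "\<dots> \<le> d ^ Suc i" using Suc.IH by simp
  finally show ?case .
qed simp

text \<open>
  In the applications any two vertices, equal ones included, are joined by a walk of length
  exactly \<open>k\<close>, which bounds the diameter from above. From below it is bounded by counting: a
  sphere of radius \<open>i\<close> has at most \<open>d ^ i\<close> elements, so the vertices at distance less than \<open>k\<close>
  from a given one cannot exhaust \<open>W\<close>.
\<close>

lemma graph_of_relation:
  fixes R :: "('v \<times> 'v) set"
  assumes fin: "finite W" and sub: "R \<subseteq> W \<times> W" and "sym R" "irrefl R"
    and deg: "\<And>v. v \<in> W \<Longrightarrow> card (R `` {v}) = d"
    and walks: "W \<times> W \<subseteq> R ^^ k"
    and large: "(\<Sum>i<k. d ^ i) < card W"
  defines "G \<equiv> \<lparr>pverts = W, parcs = R\<rparr>"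
  shows "pair_graph G \<and> Digraph_Component.connected (with_proj G) \<and> regular G d
    \<and> card (pverts G) = card W \<and> diam G = k"
proof -
  have [simp]: "pverts G = W" "parcs G = R" by (simp_all add: G_def)
  have "finite R" using fin sub finite_subset by blast
  then interpret pair_graph G
    using fin sub \<open>sym R\<close> \<open>irrefl R\<close>
    by unfold_locales (auto simp: symmetric_def irrefl_def)
  have walk: "\<exists>p. awalk u p v \<and> length p = k" if "u \<in> W" "v \<in> W" for u v
    using awalk_of_relpow[OF sub _ that(1)] walks that unfolding G_def by blast
  have path: "\<exists>p. apath u p v \<and> length p \<le> k" if uv: "u \<in> W" "v \<in> W" for u v
    using walk[OF uv] apath_of_awalk by metis
  have ne: "W \<noteq> {}" using large by auto
  have "Digraph_Component.connected (with_proj G)"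
    unfolding connected_def
  proof (rule strongly_connectedI)
    show "verts (mk_symmetric (with_proj G)) \<noteq> {}" using ne by simp
    fix u v assume "u \<in> verts (mk_symmetric (with_proj G))" "v \<in> verts (mk_symmetric (with_proj G))"
    then obtain p where "awalk u p v" using walk[of u v] by auto
    then have "u \<rightarrow>\<^sup>*\<^bsub>with_proj G\<^esub> v" by (rule reachable_awalkI)
    then show "u \<rightarrow>\<^sup>*\<^bsub>mk_symmetric (with_proj G)\<^esub> v"
      using reachable_mk_symmetric_eq[OF pair_sym_arcs] by simp
  qed
  moreover have "regular G d"
    unfolding regular_def
  proof
    fix v assume "v \<in> pverts G"
    moreover have "neighbors G v = R `` {v}" using sub by (auto simp: neighbors_def)
    ultimately show "card (neighbors G v) = d" using deg by simp
  qed
  moreover have "diam G = k"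
  proof -
    let ?D = "{distance G u v | u v. u \<in> pverts G \<and> v \<in> pverts G}"
    have upper: "distance G u v \<le> k" if uv: "u \<in> W" "v \<in> W" for u v
    proof -
      obtain p where p: "apath u p v" "length p \<le> k" using path[OF uv] by blast
      then have "distance G u v \<le> length p" unfolding distance_def by (intro Least_le) blast
      then show ?thesis using p(2) by simp
    qed
    have attained: "(u, v) \<in> R ^^ distance G u v" if uv: "u \<in> W" "v \<in> W" for u v
    proof -
      have "\<exists>n p. apath u p v \<and> length p = n" using path[OF uv] by blast
      then have "\<exists>p. apath u p v \<and> length p = distance G u v"
        unfolding distance_def by (rule LeastI_ex)
      then show ?thesis
        using relpow_of_awalk[OF sub] awalkI_apath unfolding G_def by metis
    qed
    obtain u where u: "u \<in> W" using ne by blast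
    have "\<exists>v\<in>W. k \<le> distance G u v"
    proof (rule ccontr)
      assume "\<not> ?thesis"
      then have "W \<subseteq> (\<Union>i<k. (R ^^ i) `` {u})" using attained[OF u] by force
      moreover have fin_sphere: "finite ((R ^^ i) `` {u})" for i
      proof -
        have "(R ^^ i) `` {u} \<subseteq> insert u W" using sub by (cases i) auto
        then show ?thesis using fin finite_subset by blast
      qed
      ultimately have "card W \<le> card (\<Union>i<k. (R ^^ i) `` {u})" by (intro card_mono) auto
      also have "\<dots> \<le> (\<Sum>i<k. card ((R ^^ i) `` {u}))" by (intro card_UN_le) auto
      also have "\<dots> \<le> (\<Sum>i<k. d ^ i)"
        by (intro sum_mono card_sphere_le[OF fin sub deg])
      finally show False using large by simp
    qed
    then obtain v where v: "v \<in> W" "distance G u v = k" using upper[OF u] by force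
    have "?D = (\<lambda>(u, v). distance G u v) ` (W \<times> W)" by auto
    then have "finite ?D" using fin by simp
    moreover have "k \<in> ?D" using u v by auto
    moreover have "\<forall>x\<in>?D. x \<le> k" using upper by auto
    ultimately show ?thesis unfolding diam_def by (intro Max_eqI) auto
  qed
  ultimately show ?thesis using pair_graph by simp
qed

text \<open>
  The concrete vertices below are tuples; numbering them gives a graph on natural numbers.
\<close>

lemma nat_graph_of_relation:
  fixes R :: "('v \<times> 'v) set"
  assumes fin: "finite W" and sub: "R \<subseteq> W \<times> W" and "sym R" "irrefl R"
    and deg: "\<And>v. v \<in> W \<Longrightarrow> card (R `` {v}) = d"
    and walks: "W \<times> W \<subseteq> R ^^ k"
    and large: "(\<Sum>i<k. d ^ i) < card W"
  shows "\<exists>G :: nat pair_pre_digraph. pair_graph G \<and> Digraph_Component.connected (with_proj G)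
    \<and> regular G d \<and> card (pverts G) = card W \<and> diam G = k"
proof -
  obtain f :: "'v \<Rightarrow> nat" where f: "inj_on f W"
    using finite_imp_inj_to_nat_seg[OF fin] by blast
  let ?R = "map_prod f f ` R"
  have inj: "f u = f v \<longleftrightarrow> u = v" if "u \<in> W" "v \<in> W" for u v
    using f that by (auto dest: inj_onD)
  have nbrs: "?R `` {f v} = f ` (R `` {v})" if "v \<in> W" for v
    using that sub inj by (force simp: Image_iff image_iff)
  have card: "card (f ` W) = card W" using f by (rule card_image)
  have pow: "(u, v) \<in> R ^^ j \<Longrightarrow> (f u, f v) \<in> ?R ^^ j" for u v j
  proof (induction j arbitrary: v)
    case (Suc j)
    then obtain w where "(u, w) \<in> R ^^ j" "(w, v) \<in> R" by auto
    then have "(f u, f w) \<in> ?R ^^ j" "(f w, f v) \<in> ?R" using Suc.IH by auto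
    then show ?case unfolding relpow.simps by (rule relcompI)
  qed auto
  have "\<And>v. v \<in> f ` W \<Longrightarrow> card (?R `` {v}) = d"
  proof -
    fix v' assume "v' \<in> f ` W"
    then obtain v where v: "v \<in> W" "v' = f v" by blast
    have "R `` {v} \<subseteq> W" using sub by auto
    then have "inj_on f (R `` {v})" using f inj_on_subset by blast
    then show "card (?R `` {v'}) = d" using v nbrs deg by (simp add: card_image)
  qed
  moreover have "sym ?R" using \<open>sym R\<close> by (auto simp: sym_def)
  moreover have "irrefl ?R" using \<open>irrefl R\<close> sub inj by (auto simp: irrefl_def)
  moreover have "f ` W \<times> f ` W \<subseteq> ?R ^^ k" using walks pow by auto
  moreover have "?R \<subseteq> f ` W \<times> f ` W" using sub by auto
  ultimately show ?thesis
    using graph_of_relation[of "f ` W" ?R d k] fin large unfolding card by blast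
qed

section \<open>Linear combinations and elimination\<close>

text \<open>
  The only vector operation that is needed, \<open>x + t v\<close>: a step of a walk adds a multiple of
  a fixed vector to the current one.
\<close>

fun add_mul :: "'f::field \<Rightarrow> 'f list \<Rightarrow> 'f list \<Rightarrow> 'f list" where
  "add_mul t (a # v) (b # x) = (t * a + b) # add_mul t v x"
| "add_mul t _ _ = []"

fun combine :: "'f::field list list \<Rightarrow> 'f list \<Rightarrow> 'f list \<Rightarrow> 'f list" where
  "combine (v # vs) (t # ts) x = add_mul t v (combine vs ts x)"
| "combine _ _ x = x"

text \<open>
  Stated as a transitivity property of translations, because this is the form in which walks use
  it; as \<open>y - x\<close> is arbitrary, it says that \<open>vs\<close> spans the space of vectors of length \<open>n\<close>.
\<close>

definition spans :: "nat \<Rightarrow> 'f::field list list \<Rightarrow> bool" where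
  "spans n vs \<longleftrightarrow> (\<forall>x y. length x = n \<longrightarrow> length y = n \<longrightarrow>
    (\<exists>ts. length ts = length vs \<and> combine vs ts x = y))"

lemma length_add_mul [simp]: "length (add_mul t v x) = min (length v) (length x)"
  by (induction t v x rule: add_mul.induct) auto

lemma nth_add_mul: "i < length v \<Longrightarrow> i < length x \<Longrightarrow> add_mul t v x ! i = t * v ! i + x ! i"
proof (induction t v x arbitrary: i rule: add_mul.induct)
  case (1 t a v b x)
  then show ?case by (cases i) auto
qed auto

lemma add_mul_zero: "length v = length x \<Longrightarrow> add_mul 0 v x = x"
  by (induction v x rule: list_induct2) auto

lemma add_mul_commute: "add_mul s u (add_mul t v x) = add_mul t v (add_mul s u x)"
proof (induction x arbitrary: u v)
  case (Cons a x)
  then show ?case by (cases u; cases v) (auto simp: algebra_simps)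
qed (cases u; cases v; simp)

lemma add_mul_same: "add_mul s v (add_mul t v x) = add_mul (s + t) v x"
  by (induction t v x rule: add_mul.induct) (auto simp: algebra_simps)

lemma add_mul_nested:
  "length v = length u \<Longrightarrow> length u = length x \<Longrightarrow>
    add_mul t (add_mul c v u) x = add_mul t u (add_mul (t * c) v x)"
  by (induction v u x rule: list_induct3) (auto simp: algebra_simps)

lemma length_combine:
  "\<forall>v\<in>set vs. length v = n \<Longrightarrow> length x = n \<Longrightarrow> length (combine vs ts x) = n"
  by (induction vs ts x rule: combine.induct) auto

lemma combine_add_mul: "combine vs ts (add_mul t v x) = add_mul t v (combine vs ts x)"
  by (induction vs ts x rule: combine.induct) (auto simp: add_mul_commute)

lemma combine_append:
  "length us = length ss \<Longrightarrow> combine (us @ vs) (ss @ ts) x = combine us ss (combine vs ts x)"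
  by (induction us ss rule: list_induct2) auto

lemma combine_Cons_zero: "combine (map ((#) 0) vs) ts (a # x) = a # combine vs ts x"
  by (induction vs ts x rule: combine.induct) auto

fun clear_head :: "'f::field \<Rightarrow> 'f list \<Rightarrow> 'f list \<Rightarrow> 'f list" where
  "clear_head a v (b # u) = add_mul (- (b / a)) v u"
| "clear_head a v [] = []"

text \<open>
  Gaussian elimination with an executable outcome. The vectors in \<open>us\<close> are those already seen to
  have head \<open>0\<close>, stored without it; the first vector with a nonzero head becomes the pivot, and
  only the vectors after it still need their heads cleared.
\<close>

fun eliminate :: "nat \<Rightarrow> 'f::field list list \<Rightarrow> 'f list list \<Rightarrow> bool" where
  "eliminate 0 us vs = True"
| "eliminate (Suc n) us [] = False"
| "eliminate (Suc n) us ([] # vs) = False"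
| "eliminate (Suc n) us ((a # v) # vs) =
    (if a = 0 then eliminate (Suc n) (us @ [v]) vs
     else eliminate n [] (us @ map (clear_head a v) vs))"

text \<open>
  Clearing the heads of the vectors \<open>ws\<close> with a pivot changes a combination of them by a multiple
  of the pivot, and this multiple depends on the coefficients only, not on the starting point.
\<close>

lemma combine_clear_head:
  fixes a :: "'f::field"
  assumes "a \<noteq> 0" "length v = n" "\<forall>w\<in>set ws. length w = Suc n"
  shows "\<exists>s. \<forall>x. length x = Suc n \<longrightarrow>
    combine ws ts x = combine (map (\<lambda>w. 0 # clear_head a v w) ws) ts (add_mul s (a # v) x)"
  using assms(3)
proof (induction ws arbitrary: ts)
  case Nil
  then show ?case using assms(2) by (auto intro!: exI[of _ 0] simp: add_mul_zero)
next
  case (Cons w ws)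
  show ?case
  proof (cases ts)
    case Nil
    then show ?thesis using assms(2) by (auto intro!: exI[of _ 0] simp: add_mul_zero)
  next
    case ts: (Cons t ts')
    obtain b u where w: "w = b # u" "length u = n" using Cons.prems by (cases w) auto
    let ?ws = "map (\<lambda>w. 0 # clear_head a v w) ws"
    obtain s where s: "\<And>x. length x = Suc n \<Longrightarrow>
        combine ws ts' x = combine ?ws ts' (add_mul s (a # v) x)"
      using Cons.IH[of ts'] Cons.prems by auto
    have len: "length (combine ws ts' x) = Suc n" if "length x = Suc n" for x
      using Cons.prems that by (intro length_combine) auto
    have cleared: "0 # clear_head a v w = add_mul (- (b / a)) (a # v) w"
      using w assms(1) by simp
    have "combine (w # ws) ts x =
        combine (map (\<lambda>w. 0 # clear_head a v w) (w # ws)) ts (add_mul (t * (b / a) + s) (a # v) x)"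
      if x: "length x = Suc n" for x
    proof -
      let ?y = "combine ws ts' x"
      have "combine (map (\<lambda>w. 0 # clear_head a v w) (w # ws)) ts
              (add_mul (t * (b / a) + s) (a # v) x)
          = add_mul t (0 # clear_head a v w)
              (combine ?ws ts' (add_mul (t * (b / a)) (a # v) (add_mul s (a # v) x)))"
        by (simp add: ts add_mul_same)
      also have "\<dots> = add_mul t (add_mul (- (b / a)) (a # v) w) (add_mul (t * (b / a)) (a # v) ?y)"
        unfolding combine_add_mul cleared using s[OF x] by (simp only: combine_add_mul)
      also have "\<dots> = add_mul t w (add_mul (t * - (b / a)) (a # v) (add_mul (t * (b / a)) (a # v) ?y))"
        using assms(2) w len[OF x] by (intro add_mul_nested) auto
      also have "\<dots> = add_mul t w ?y"
        unfolding add_mul_same using assms(2) len[OF x] by (simp add: add_mul_zero)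
      finally show ?thesis by (simp add: ts)
    qed
    then show ?thesis by blast
  qed
qed

text \<open>
  To move from \<open>x\<close> to \<open>y\<close>, the pivot first corrects the head; the cleared vectors then correct the
  rest by induction, and their use of the original vectors is paid for by changing the
  coefficient of the pivot once more.
\<close>

lemma eliminate_spans:
  fixes us vs :: "'f::field list list"
  assumes "eliminate n us vs" "\<forall>u\<in>set us. Suc (length u) = n" "\<forall>v\<in>set vs. length v = n"
  shows "spans n (map ((#) 0) us @ vs)"
  using assms
proof (induction n us vs rule: eliminate.induct)
  case (1 us vs)
  then have "us = []" "\<forall>v\<in>set vs. length v = 0" by auto
  then have "length (combine vs ts []) = 0" for ts by (intro length_combine) auto
  then show ?case using \<open>us = []\<close> by (auto simp: spans_def intro: Ex_list_of_length)
next
  case (4 n us a v vs)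
  show ?case
  proof (cases "a = 0")
    case True
    then show ?thesis using 4 by simp
  next
    case False
    have lens: "length v = n" "\<forall>w\<in>set vs. length w = Suc n" "\<forall>u\<in>set us. length u = n"
      using 4(4,5) by auto
    have "length (clear_head a v w) = n" if "w \<in> set vs" for w
    proof -
      have "length w = Suc n" using that lens by blast
      then show ?thesis using lens(1) by (cases w) auto
    qed
    then have IH: "spans n (us @ map (clear_head a v) vs)"
      using 4(2)[OF False] 4(3) False lens by auto
    show ?thesis
      unfolding spans_def
    proof (intro allI impI)
      fix x y :: "'f list" assume "length x = Suc n" "length y = Suc n"
      then obtain x0 x' y0 y' where xy: "x = x0 # x'" "y = y0 # y'" "length x' = n" "length y' = n"
        by (metis length_Suc_conv)
      \<comment> \<open>the multiple of the pivot that turns the head of \<open>x\<close> into that of \<open>y\<close>\<close>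
      define s where "s = (y0 - x0) / a"
      define z where "z = add_mul s v x'"
      have head: "add_mul s (a # v) x = y0 # z" using False by (simp add: s_def z_def xy)
      have "length z = n" using lens xy by (simp add: z_def)
      with IH xy obtain ts where ts: "length ts = length us + length vs"
        "combine (us @ map (clear_head a v) vs) ts z = y'"
        unfolding spans_def by fastforce
      define ts1 ts2 where "ts1 = take (length us) ts" and "ts2 = drop (length us) ts"
      have ts12: "ts = ts1 @ ts2" "length ts1 = length us" "length ts2 = length vs"
        using ts(1) by (auto simp: ts1_def ts2_def)
      let ?ws = "map (\<lambda>w. 0 # clear_head a v w) vs"
      obtain r where r: "\<And>x. length x = Suc n \<Longrightarrow>
          combine vs ts2 x = combine ?ws ts2 (add_mul r (a # v) x)"
        using combine_clear_head[OF False lens(1,2), of ts2] by blast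
      have ws: "map ((#) 0) (us @ map (clear_head a v) vs) = map ((#) 0) us @ ?ws" by simp
      have "combine (map ((#) 0) us @ (a # v) # vs) (ts1 @ (s - r) # ts2) x
          = combine (map ((#) 0) us) ts1 (add_mul (s - r) (a # v) (combine vs ts2 x))"
        using ts12 by (simp add: combine_append)
      also have "\<dots> = combine (map ((#) 0) us) ts1 (combine ?ws ts2 (add_mul s (a # v) x))"
        using r[of x] xy by (simp add: combine_add_mul[symmetric] add_mul_same del: add_mul.simps)
      also have "\<dots> = combine (map ((#) 0) (us @ map (clear_head a v) vs)) ts (y0 # z)"
        unfolding ws head ts12(1) using ts12(2) by (simp add: combine_append)
      also have "\<dots> = y" unfolding combine_Cons_zero ts(2) xy ..
      finally show "\<exists>ts. length ts = length (map ((#) 0) us @ (a # v) # vs) \<and>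
          combine (map ((#) 0) us @ (a # v) # vs) ts x = y"
        using ts12 by (intro exI[of _ "ts1 @ (s - r) # ts2"]) simp
    qed
  qed
qed auto

section \<open>Monomial maps\<close>

text \<open>
  Multiplication by a matrix with one nonzero entry in each row: the entry \<open>(i, c)\<close> of \<open>m\<close> at
  position \<open>k\<close> stands for the value \<open>c\<close> in row \<open>k\<close> and column \<open>i\<close>.
\<close>

definition monomial :: "(nat \<times> 'f::field) list \<Rightarrow> 'f list \<Rightarrow> 'f list" where
  "monomial m x = map (\<lambda>(i, c). c * x ! i) m"

lemma length_monomial [simp]: "length (monomial m x) = length m"
  by (simp add: monomial_def)

lemma monomial_add_mul:
  assumes "\<forall>(i, c)\<in>set m. i < n" "length v = n" "length x = n"
  shows "monomial m (add_mul t v x) = add_mul t (monomial m v) (monomial m x)"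
proof (rule nth_equalityI)
  fix k assume "k < length (monomial m (add_mul t v x))"
  moreover obtain i c where "m ! k = (i, c)" by fastforce
  ultimately have "k < length m" "m ! k = (i, c)" "i < n"
    using assms(1) nth_mem[of k m] by auto
  then show "monomial m (add_mul t v x) ! k = add_mul t (monomial m v) (monomial m x) ! k"
    using assms by (simp add: nth_add_mul monomial_def algebra_simps)
qed simp

lemma monomial_combine:
  assumes "\<forall>(i, c)\<in>set m. i < n" "\<forall>v\<in>set vs. length v = n" "length x = n"
  shows "monomial m (combine vs ts x) = combine (map (monomial m) vs) ts (monomial m x)"
  using assms(2,3)
  by (induction vs ts x rule: combine.induct)
    (auto simp: monomial_add_mul[OF assms(1)] length_combine)

text \<open>
  The left-hand side is the matrix of \<open>m'\<close> times that of \<open>m\<close>, in the encoding of \<open>monomial\<close>.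
\<close>

definition inverse_monomials :: "nat \<Rightarrow> (nat \<times> 'f::field) list \<Rightarrow> (nat \<times> 'f) list \<Rightarrow> bool" where
  "inverse_monomials n m m' \<longleftrightarrow>
    map (\<lambda>(j, d). (fst (m ! j), d * snd (m ! j))) m' = map (\<lambda>i. (i, 1)) [0..<n]"

lemma monomial_inverse:
  assumes inv: "inverse_monomials n m m'"
    and m: "length m = n" "length m' = n" "\<forall>(j, d)\<in>set m'. j < n" and x: "length x = n"
  shows "monomial m' (monomial m x) = x"
proof (rule nth_equalityI)
  show "length (monomial m' (monomial m x)) = length x" using m x by simp
  fix k assume "k < length (monomial m' (monomial m x))"
  then have k: "k < n" "k < length m'" using m by simp_all
  obtain j d where jd: "m' ! k = (j, d)" by fastforce
  then have "j < n" using m(3) nth_mem[OF k(2)] by auto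
  have "map (\<lambda>(j, d). (fst (m ! j), d * snd (m ! j))) m' ! k = map (\<lambda>i. (i, 1)) [0..<n] ! k"
    using inv by (simp add: inverse_monomials_def)
  then have "fst (m ! j) = k" "d * snd (m ! j) = 1" using k jd by simp_all
  then show "monomial m' (monomial m x) ! k = x ! k"
    using k jd \<open>j < n\<close> m by (simp add: monomial_def case_prod_beta mult.assoc[symmetric])
qed

section \<open>Twisted lifts\<close>

text \<open>
  An arc of a base graph with voltages. Over each vertex \<open>(p, g)\<close> of the base graph, where \<open>p\<close> is a
  number and \<open>g\<close> a group element, lies a copy of the space of vectors. An arc \<open>a\<close> with source \<open>p\<close>
  leads from \<open>(p, g)\<close> to \<open>(target a, g \<otimes> shift a)\<close>, and above it \<open>x\<close> is joined to the
  vectors \<open>T (x + t d)\<close>, where \<open>T\<close> is the monomial map \<open>twist a\<close>, \<open>d = direction a\<close>, and \<open>t\<close> ranges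
  over the field.
\<close>

datatype ('g, 'f) arc =
  Arc (source: nat) (target: nat) (shift: 'g) (twist: "(nat \<times> 'f) list") (direction: "'f list")

text \<open>
  An exhaustive search for ends of walks of length \<open>k\<close> that reach whole fibres. The vectors
  reachable above \<open>(p, h)\<close> by the walk so far are \<open>c + span vs\<close> for some \<open>c\<close>; a further arc adds its
  direction to the list and maps everything by its twist. The end of a walk is kept
  if finally \<open>vs\<close> spans the space, so that every vector in the fibre is reached.

  An arc whose direction is already listed cannot enlarge the span and is skipped. This excludes
  in particular going back along the last arc: the direction of the reverse of \<open>a\<close> is
  \<open>direction a\<close> mapped by \<open>twist a\<close>, which is the head of the list.
\<close>

fun walk_ends :: "('g \<Rightarrow> 'g \<Rightarrow> 'g) \<Rightarrow> ('g, 'f::field) arc list \<Rightarrow> nat \<Rightarrow>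
    nat \<Rightarrow> nat \<Rightarrow> 'g \<Rightarrow> 'f list list \<Rightarrow> (nat \<times> 'g) list" where
  "walk_ends op as n 0 p h vs = (if eliminate n [] vs then [(p, h)] else [])"
| "walk_ends op as n (Suc k) p h vs = concat (map
    (\<lambda>a. walk_ends op as n k (target a) (op h (shift a)) (map (monomial (twist a)) (direction a # vs)))
    (filter (\<lambda>a. source a = p \<and> \<not> List.member vs (direction a)) as))"

text \<open>
  The lift has \<open>m\<close> orbits of base vertices under the group, fibres of dimension \<open>n\<close>, and a base
  graph of degree \<open>b\<close>. The assumption \<open>reversible\<close> makes the relation symmetric: from
  \<open>y = T (x + t d)\<close> one returns by \<open>x = T\<^sup>-\<^sup>1 (y - t (T d))\<close>, a step along an arc with twist
  \<open>T\<^sup>-\<^sup>1\<close> and direction \<open>T d\<close>. The twists around a closed walk of the base graph need not multiply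
  to the identity. Left multiplication by a group element preserves everything, so \<open>covering\<close> looks
  at walks from the unit element only.
\<close>

locale twisted_lift = group \<Gamma> for \<Gamma> :: "'g monoid" (structure) +
  fixes arcs :: "('g, 'f::{field,finite}) arc list" and m n b :: nat
  assumes finite_group: "finite (carrier \<Gamma>)"
    and arc_wf: "a \<in> set arcs \<Longrightarrow> source a < m \<and> target a < m \<and> shift a \<in> carrier \<Gamma> \<and>
      length (direction a) = n \<and> length (twist a) = n \<and> (\<forall>(i, c)\<in>set (twist a). i < n) \<and>
      (\<exists>c\<in>set (direction a). c \<noteq> 0)"
    and reversible: "a \<in> set arcs \<Longrightarrow> \<exists>a'\<in>set arcs. source a' = target a \<and> target a' = source a \<and>
      shift a \<otimes> shift a' = \<one> \<and> inverse_monomials n (twist a) (twist a') \<and>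
      direction a' = monomial (twist a) (direction a)"
    and distinct_ends: "distinct (map (\<lambda>a. (source a, target a, shift a)) arcs)"
    and out_degree: "p < m \<Longrightarrow> length (filter (\<lambda>a. source a = p) arcs) = b"
    and no_loop: "a \<in> set arcs \<Longrightarrow> source a = target a \<Longrightarrow> shift a \<noteq> \<one>"
    and covering: "p < m \<Longrightarrow> {..<m} \<times> carrier \<Gamma> \<subseteq> set (walk_ends (\<otimes>) arcs n n p \<one> [])"
begin

definition vertices :: "(nat \<times> 'g \<times> 'f list) set" where
  "vertices = {..<m} \<times> carrier \<Gamma> \<times> {x. length x = n}"

definition move :: "'g \<Rightarrow> 'f list \<Rightarrow> ('g, 'f) arc \<Rightarrow> 'f \<Rightarrow> nat \<times> 'g \<times> 'f list" where
  "move g x a t = (target a, g \<otimes> shift a, monomial (twist a) (add_mul t (direction a) x))"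

definition links :: "((nat \<times> 'g \<times> 'f list) \<times> (nat \<times> 'g \<times> 'f list)) set" where
  "links = {((source a, g, x), move g x a t) | a g x t. a \<in> set arcs \<and> g \<in> carrier \<Gamma> \<and> length x = n}"

lemma lists_eq: "{x :: 'f list. length x = n} = {x. set x \<subseteq> UNIV \<and> length x = n}"
  by simp

lemma finite_vertices: "finite vertices"
  unfolding vertices_def lists_eq
  using finite_group finite_lists_length_eq[of "UNIV :: 'f set" n] by simp

lemma card_vertices: "card vertices = m * card (carrier \<Gamma>) * CARD('f) ^ n"
  unfolding vertices_def lists_eq
  using card_lists_length_eq[of "UNIV :: 'f set" n] by (simp add: card_cartesian_product)

lemma links_vertices: "links \<subseteq> vertices \<times> vertices"
  using arc_wf by (auto simp: links_def vertices_def move_def)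

lemma untwist:
  assumes "a \<in> set arcs" "a' \<in> set arcs" "inverse_monomials n (twist a) (twist a')" "length x = n"
  shows "monomial (twist a') (monomial (twist a) x) = x"
  using monomial_inverse[OF assms(3)] arc_wf[OF assms(1)] arc_wf[OF assms(2)] assms(4) by simp

lemma sym_links: "sym links"
proof (rule symI)
  fix u v assume "(u, v) \<in> links"
  then obtain a g x t where u: "u = (source a, g, x)" and v: "v = move g x a t"
    and a: "a \<in> set arcs" and g: "g \<in> carrier \<Gamma>" and x: "length x = n"
    unfolding links_def by blast
  obtain a' where a': "a' \<in> set arcs" "source a' = target a" "target a' = source a"
    "shift a \<otimes> shift a' = \<one>" "inverse_monomials n (twist a) (twist a')"
    "direction a' = monomial (twist a) (direction a)"
    using reversible[OF a] by blast
  note wf = arc_wf[OF a] arc_wf[OF a'(1)]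
  let ?y = "add_mul t (direction a) x"
  have y: "length ?y = n" using wf x by simp
  have "add_mul (- t) (direction a') (monomial (twist a) ?y)
      = monomial (twist a) (add_mul (- t) (direction a) ?y)"
    unfolding a'(6) using wf y by (intro monomial_add_mul[symmetric]) auto
  also have "add_mul (- t) (direction a) ?y = x"
    unfolding add_mul_same using wf x by (simp add: add_mul_zero)
  finally have "monomial (twist a') (add_mul (- t) (direction a') (monomial (twist a) ?y)) = x"
    using untwist[OF a a'(1,5) x] by simp
  moreover have "g \<otimes> shift a \<otimes> shift a' = g" using g wf a'(4) by (simp add: m_assoc)
  ultimately have "move (g \<otimes> shift a) (monomial (twist a) ?y) a' (- t) = u"
    by (simp add: move_def u a'(3))
  moreover have "(v, move (g \<otimes> shift a) (monomial (twist a) ?y) a' (- t)) \<in> links"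
  proof -
    have "v = (source a', g \<otimes> shift a, monomial (twist a) ?y)" by (simp add: v move_def a'(2))
    moreover have "g \<otimes> shift a \<in> carrier \<Gamma>" "length (monomial (twist a) ?y) = n"
      using g wf by simp_all
    ultimately show ?thesis unfolding links_def using a'(1) by blast
  qed
  ultimately show "(v, u) \<in> links" by simp
qed

lemma irrefl_links: "irrefl links"
proof (rule irreflI)
  fix u show "(u, u) \<notin> links"
  proof
    assume "(u, u) \<in> links"
    then obtain a g where a: "a \<in> set arcs" "g \<in> carrier \<Gamma>" "source a = target a" "g = g \<otimes> shift a"
      unfolding links_def move_def by auto
    then have "shift a = \<one>" using arc_wf[OF a(1)] l_cancel_one' by simp
    then show False using no_loop[OF a(1,3)] by simp
  qed
qed

text \<open>
  Different arcs lead to different fibres, and above one arc different coefficients \<open>t\<close> lead to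
  different vectors, because the direction is nonzero and the twist injective.
\<close>

lemma card_links:
  assumes "v \<in> vertices"
  shows "card (links `` {v}) = b * CARD('f)"
proof -
  obtain p g x where v: "v = (p, g, x)" "p < m" "g \<in> carrier \<Gamma>" "length x = n"
    using assms unfolding vertices_def by auto
  let ?A = "{a \<in> set arcs. source a = p}"
  have "links `` {v} = (\<lambda>(a, t). move g x a t) ` (?A \<times> UNIV)"
  proof (intro equalityI subsetI)
    fix w assume "w \<in> links `` {v}"
    then obtain a t where "a \<in> set arcs" "source a = p" "w = move g x a t"
      unfolding links_def v by auto
    then show "w \<in> (\<lambda>(a, t). move g x a t) ` (?A \<times> UNIV)" by (intro image_eqI[of _ _ "(a, t)"]) auto
  qed (use v in \<open>auto simp: links_def\<close>)
  moreover have "inj_on (\<lambda>(a, t). move g x a t) (?A \<times> UNIV)"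
  proof (rule inj_onI, clarify)
    fix a a' t t'
    assume a: "a \<in> set arcs" and p: "p = source a" and a': "a' \<in> set arcs" "source a' = source a"
      and eq: "move g x a t = move g x a' t'"
    note wf = arc_wf[OF a] arc_wf[OF a'(1)]
    have "target a = target a'" "shift a = shift a'"
      using eq v wf by (auto simp: move_def)
    then have same: "a = a'"
      using distinct_ends a a' inj_onD[of "\<lambda>a. (source a, target a, shift a)" "set arcs" a a']
      by (simp add: distinct_map)
    obtain a'' where a'': "a'' \<in> set arcs" "inverse_monomials n (twist a) (twist a'')"
      using reversible[OF a] by blast
    have "monomial (twist a) (add_mul t (direction a) x) = monomial (twist a) (add_mul t' (direction a) x)"
      using eq same by (simp add: move_def)
    moreover have "length (add_mul s (direction a) x) = n" for s using wf v(4) by simp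
    ultimately have eq': "add_mul t (direction a) x = add_mul t' (direction a) x"
      using untwist[OF a a''] by metis
    obtain i where i: "i < n" "direction a ! i \<noteq> 0"
      using wf by (auto simp: in_set_conv_nth)
    then have "t * direction a ! i + x ! i = t' * direction a ! i + x ! i"
      using arg_cong[OF eq', of "\<lambda>z. z ! i"] wf v(4) by (simp add: nth_add_mul)
    then show "a = a' \<and> t = t'" using same i by simp
  qed
  moreover have "card ?A = b"
  proof -
    have "distinct arcs" using distinct_ends by (simp add: distinct_map)
    then show ?thesis
      using out_degree[OF v(2)] distinct_card[of "filter (\<lambda>a. source a = p) arcs"] by simp
  qed
  ultimately show ?thesis by (simp add: card_image card_cartesian_product)
qed

text \<open>
  The invariant of the search. The start \<open>u\<close> of the walk, the group element \<open>g\<close> that translates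
  it and the offset \<open>c\<close> of the set of reachable vectors do not occur in the search itself.
\<close>

lemma walk_ends_links:
  assumes "(q, h') \<in> set (walk_ends (\<otimes>) arcs n k p h vs)"
    and "h \<in> carrier \<Gamma>" "\<forall>v\<in>set vs. length v = n" "g \<in> carrier \<Gamma>" "length c = n" "length y = n"
    and "\<And>ts. length ts = length vs \<Longrightarrow> (u, (p, g \<otimes> h, combine vs ts c)) \<in> links ^^ j"
  shows "(u, (q, g \<otimes> h', y)) \<in> links ^^ (j + k)"
  using assms
proof (induction k arbitrary: p h vs j c)
  case 0
  then have "eliminate n [] vs" and q: "q = p" "h' = h" by (auto split: if_splits)
  then have "spans n vs" using eliminate_spans[of n "[]" vs] 0(3) by simp
  then obtain ts where "length ts = length vs" "combine vs ts c = y"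
    using 0(5,6) unfolding spans_def by blast
  then show ?case using 0(7) q by auto
next
  case (Suc k)
  then obtain a where a: "a \<in> set arcs" "source a = p"
    and rest: "(q, h') \<in> set (walk_ends (\<otimes>) arcs n k (target a) (h \<otimes> shift a)
      (map (monomial (twist a)) (direction a # vs)))"
    by auto
  note wf = arc_wf[OF a(1)]
  have "(u, (q, g \<otimes> h', y)) \<in> links ^^ (Suc j + k)"
  proof (rule Suc.IH[OF rest])
    show "h \<otimes> shift a \<in> carrier \<Gamma>" using Suc.prems wf by simp
    show "\<forall>v\<in>set (map (monomial (twist a)) (direction a # vs)). length v = n" using wf by simp
    show "length (monomial (twist a) c) = n" using wf by simp
    fix ts :: "'f list" assume "length ts = length (map (monomial (twist a)) (direction a # vs))"
    then obtain t ts' where ts: "ts = t # ts'" "length ts' = length vs"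
      by (cases ts) auto
    let ?x = "combine vs ts' c"
    have x: "length ?x = n" using Suc.prems by (intro length_combine) auto
    have "((p, g \<otimes> h, ?x), move (g \<otimes> h) ?x a t) \<in> links"
      unfolding links_def using a x Suc.prems by auto
    moreover have "move (g \<otimes> h) ?x a t = (target a, g \<otimes> (h \<otimes> shift a),
        combine (map (monomial (twist a)) (direction a # vs)) ts (monomial (twist a) c))"
    proof -
      have "combine (map (monomial (twist a)) (direction a # vs)) ts (monomial (twist a) c)
          = monomial (twist a) (combine (direction a # vs) ts c)"
        using wf Suc.prems by (intro monomial_combine[symmetric]) auto
      then show ?thesis using wf Suc.prems by (simp add: move_def ts m_assoc)
    qed
    ultimately show "(u, (target a, g \<otimes> (h \<otimes> shift a),
        combine (map (monomial (twist a)) (direction a # vs)) ts (monomial (twist a) c))) \<in> links ^^ Suc j"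
      using Suc.prems(7)[OF ts(2)] by auto
  qed (use Suc.prems in auto)
  then show ?case by simp
qed

text \<open>
  A walk from \<open>(p, g)\<close> to \<open>(q, g')\<close> is the translate by \<open>g\<close> of one from \<open>(p, \<one>)\<close> to
  \<open>(q, inv g \<otimes> g')\<close>.
\<close>

lemma links_relpow: "vertices \<times> vertices \<subseteq> links ^^ n"
proof clarify
  fix p g x q g' y
  assume "(p, g, x) \<in> vertices" "(q, g', y) \<in> vertices"
  then have v: "p < m" "q < m" "g \<in> carrier \<Gamma>" "g' \<in> carrier \<Gamma>" "length x = n" "length y = n"
    unfolding vertices_def by auto
  have "(q, inv g \<otimes> g') \<in> set (walk_ends (\<otimes>) arcs n n p \<one> [])"
    using covering[OF v(1)] v by auto
  then have "((p, g, x), (q, g \<otimes> (inv g \<otimes> g'), y)) \<in> links ^^ (0 + n)"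
    by (rule walk_ends_links[where c = x]) (use v in auto)
  then show "((p, g, x), (q, g', y)) \<in> links ^^ n" using v by (simp add: m_assoc[symmetric])
qed

theorem nat_graph_of_lift:
  assumes "(\<Sum>i<n. (b * CARD('f)) ^ i) < m * card (carrier \<Gamma>) * CARD('f) ^ n"
  shows "\<exists>G :: nat pair_pre_digraph. pair_graph G \<and> Digraph_Component.connected (with_proj G)
    \<and> regular G (b * CARD('f)) \<and> card (pverts G) = m * card (carrier \<Gamma>) * CARD('f) ^ n \<and> diam G = n"
proof -
  have "(\<Sum>i<n. (b * CARD('f)) ^ i) < card vertices" using assms by (simp add: card_vertices)
  from nat_graph_of_relation[OF finite_vertices links_vertices sym_links irrefl_links
      card_links links_relpow this]
  show ?thesis unfolding card_vertices by simp
qed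

end

section \<open>The fields with three and four elements\<close>

text \<open>
  Given by their tables, so that rewriting can compute in them.
\<close>

datatype gf3 = Zero3 | One3 | Two3

instantiation gf3 :: field
begin
definition "0 = Zero3"
definition "1 = One3"
fun plus_gf3 where
  "Zero3 + x = x" | "x + Zero3 = x"
| "One3 + One3 = Two3" | "One3 + Two3 = Zero3" | "Two3 + One3 = Zero3" | "Two3 + Two3 = (One3 :: gf3)"
fun times_gf3 where
  "Zero3 * x = Zero3" | "One3 * x = x"
| "Two3 * Zero3 = Zero3" | "Two3 * One3 = Two3" | "Two3 * Two3 = (One3 :: gf3)"
fun uminus_gf3 where "- Zero3 = Zero3" | "- One3 = Two3" | "- Two3 = (One3 :: gf3)"
definition "x - y = x + - (y :: gf3)"
\<comment> \<open>the units are \<open>1\<close> and \<open>- 1\<close>\<close>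
definition "inverse x = (x :: gf3)"
definition "x div y = x * inverse (y :: gf3)"
instance
proof
  fix x y z :: gf3
  show "x + y + z = x + (y + z)" by (cases x; cases y; cases z) simp_all
  show "x + y = y + x" by (cases x; cases y) simp_all
  show "0 + x = x" by (simp add: zero_gf3_def)
  show "- x + x = 0" by (cases x) (simp_all add: zero_gf3_def)
  show "x - y = x + - y" by (rule minus_gf3_def)
  show "x * y * z = x * (y * z)" by (cases x; cases y; cases z) simp_all
  show "x * y = y * x" by (cases x; cases y) simp_all
  show "1 * x = x" by (simp add: one_gf3_def)
  show "(x + y) * z = x * z + y * z" by (cases x; cases y; cases z) simp_all
  show "(0 :: gf3) \<noteq> 1" by (simp add: zero_gf3_def one_gf3_def)
  show "x \<noteq> 0 \<Longrightarrow> inverse x * x = 1"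
    by (cases x) (simp_all add: zero_gf3_def one_gf3_def inverse_gf3_def)
  show "x div y = x * inverse y" by (rule divide_gf3_def)
  show "inverse (0 :: gf3) = 0" by (rule inverse_gf3_def)
qed
end

lemma UNIV_gf3: "UNIV = {Zero3, One3, Two3}"
  using gf3.exhaust by auto

instance gf3 :: finite
  by standard (simp add: UNIV_gf3)

lemma card_gf3: "CARD(gf3) = 3"
  by (simp add: UNIV_gf3)

text \<open>
  Here \<open>Om\<close> is a primitive cube root of unity and \<open>Om'\<close> its square, so \<open>1 + Om + Om' = 0\<close>.
\<close>

datatype gf4 = Zero4 | One4 | Om | Om'

instantiation gf4 :: field
begin
definition "0 = Zero4"
definition "1 = One4"
fun plus_gf4 where
  "Zero4 + x = x" | "x + Zero4 = x"
| "One4 + One4 = Zero4" | "One4 + Om = Om'" | "One4 + Om' = Om"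
| "Om + One4 = Om'" | "Om + Om = Zero4" | "Om + Om' = One4"
| "Om' + One4 = Om" | "Om' + Om = One4" | "Om' + Om' = (Zero4 :: gf4)"
fun times_gf4 where
  "Zero4 * x = Zero4" | "One4 * x = x"
| "Om * Zero4 = Zero4" | "Om * One4 = Om" | "Om * Om = Om'" | "Om * Om' = One4"
| "Om' * Zero4 = Zero4" | "Om' * One4 = Om'" | "Om' * Om = One4" | "Om' * Om' = (Om :: gf4)"
definition "- x = (x :: gf4)"
definition "x - y = x + - (y :: gf4)"
\<comment> \<open>the units are cube roots of unity\<close>
definition "inverse x = x * (x :: gf4)"
definition "x div y = x * inverse (y :: gf4)"
instance
proof
  fix x y z :: gf4
  show "x + y + z = x + (y + z)" by (cases x; cases y; cases z) simp_all
  show "x + y = y + x" by (cases x; cases y) simp_all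
  show "0 + x = x" by (simp add: zero_gf4_def)
  show "- x + x = 0" by (cases x) (simp_all add: zero_gf4_def uminus_gf4_def)
  show "x - y = x + - y" by (rule minus_gf4_def)
  show "x * y * z = x * (y * z)" by (cases x; cases y; cases z) simp_all
  show "x * y = y * x" by (cases x; cases y) simp_all
  show "1 * x = x" by (simp add: one_gf4_def)
  show "(x + y) * z = x * z + y * z" by (cases x; cases y; cases z) simp_all
  show "(0 :: gf4) \<noteq> 1" by (simp add: zero_gf4_def one_gf4_def)
  show "x \<noteq> 0 \<Longrightarrow> inverse x * x = 1"
    by (cases x) (simp_all add: zero_gf4_def one_gf4_def inverse_gf4_def)
  show "x div y = x * inverse y" by (rule divide_gf4_def)
  show "inverse (0 :: gf4) = 0" by (simp add: inverse_gf4_def zero_gf4_def)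
qed
end

lemma UNIV_gf4: "UNIV = {Zero4, One4, Om, Om'}"
  using gf4.exhaust by auto

instance gf4 :: finite
  by standard (simp add: UNIV_gf4)

lemma card_gf4: "CARD(gf4) = 4"
  by (simp add: UNIV_gf4)

section \<open>The group of order 48\<close>

text \<open>
  The semidirect product of the cyclic groups of orders \<open>4\<close> and \<open>12\<close> in which a generator of the
  second factor inverts the elements of the first one.
\<close>

fun semidirect :: "int \<times> int \<Rightarrow> int \<times> int \<Rightarrow> int \<times> int" where
  "semidirect (x, e) (y, f) = ((if even e then x + y else x - y) mod 4, (e + f) mod 12)"

definition base_group :: "(int \<times> int) monoid" where
  "base_group = \<lparr>carrier = {0..3} \<times> {0..11}, mult = semidirect, one = (0, 0)\<rparr>"

lemma base_group_simps [simp]: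
  "carrier base_group = {0..3} \<times> {0..11}" "mult base_group = semidirect" "one base_group = (0, 0)"
  by (simp_all add: base_group_def)

fun inv_semidirect :: "int \<times> int \<Rightarrow> int \<times> int" where
  "inv_semidirect (x, e) = ((if even e then - x else x) mod 4, - e mod 12)"

lemma group_base_group: "group base_group"
proof (rule groupI)
  have even: "even (e mod 12) = even e" for e :: int by presburger
  fix g h k assume "g \<in> carrier base_group"
  then obtain x e where g: "g = (x, e)" "0 \<le> x" "x < 4" "0 \<le> e" "e < 12" by auto
  show "\<one>\<^bsub>base_group\<^esub> \<otimes>\<^bsub>base_group\<^esub> g = g" using g by simp
  show "\<exists>h\<in>carrier base_group. h \<otimes>\<^bsub>base_group\<^esub> g = \<one>\<^bsub>base_group\<^esub>"
    using g by (intro bexI[of _ "inv_semidirect g"]) (auto simp: even mod_simps)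
  show "g \<otimes>\<^bsub>base_group\<^esub> h \<otimes>\<^bsub>base_group\<^esub> k = g \<otimes>\<^bsub>base_group\<^esub> (h \<otimes>\<^bsub>base_group\<^esub> k)"
    by (cases h; cases k) (auto simp: g even mod_simps algebra_simps)
  assume "h \<in> carrier base_group"
  then show "g \<otimes>\<^bsub>base_group\<^esub> h \<in> carrier base_group" by (cases h) (auto simp: g)
qed auto

section \<open>The two systems of arcs\<close>

text \<open>
  If row \<open>j\<close> has its entry in column \<open>i\<close>, then row \<open>i\<close> of the inverse has its entry in column \<open>j\<close>.
\<close>

definition inverse_monomial :: "(nat \<times> 'f::field) list \<Rightarrow> (nat \<times> 'f) list" where
  "inverse_monomial m = map (\<lambda>i. let j = hd (filter (\<lambda>j. fst (m ! j) = i) [0..<length m])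
    in (j, inverse (snd (m ! j)))) [0..<length m]"

definition reversed :: "(int \<times> int, 'f::field) arc \<Rightarrow> (int \<times> int, 'f) arc" where
  "reversed a = Arc (target a) (source a) (inv_semidirect (shift a)) (inverse_monomial (twist a))
    (monomial (twist a) (direction a))"

text \<open>
  Both lifts have the same base graph. Up to the action of the group, it has vertices \<open>0\<close>, \<open>1\<close>, \<open>2\<close>,
  a loop at each of \<open>0\<close> and \<open>1\<close>, and two edges joining each of \<open>0\<close> and \<open>1\<close> to \<open>2\<close>; so it is
  \<open>4\<close>-regular with \<open>144\<close> vertices. The shifts were found by a search for a graph in which any two
  vertices are joined by a non-backtracking walk of length \<open>5\<close>; there are only
  \<open>4 * 3 ^ 4 = 324\<close> such walks from a given vertex to cover \<open>144\<close> ends.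
  The twists and directions were then found, for each field, by a search for independence along
  enough of these walks. The second and third edge form a spanning tree of the quotient; a choice
  of coordinates in the fibres makes the twists along it the identity.
\<close>

definition edges3 :: "(int \<times> int, gf3) arc list" where
  "edges3 =
    [Arc 0 0 (0, 5) [(4, One3), (1, Two3), (0, Two3), (3, Two3), (2, Two3)] [One3, One3, One3, Zero3, Zero3],
     Arc 0 2 (3, 11) [(0, One3), (1, One3), (2, One3), (3, One3), (4, One3)] [Two3, One3, Zero3, One3, Two3],
     Arc 2 1 (0, 10) [(0, One3), (1, One3), (2, One3), (3, One3), (4, One3)] [One3, Two3, One3, One3, One3],
     Arc 1 1 (3, 11) [(3, Two3), (1, Two3), (2, Two3), (4, Two3), (0, One3)] [Two3, One3, One3, Two3, Two3],
     Arc 0 2 (0, 6) [(3, Two3), (2, Two3), (1, One3), (4, One3), (0, One3)] [Zero3, One3, Zero3, Zero3, Two3],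
     Arc 2 1 (0, 5) [(2, One3), (3, Two3), (4, Two3), (1, One3), (0, Two3)] [Two3, One3, One3, Zero3, Two3]]"

definition edges4 :: "(int \<times> int, gf4) arc list" where
  "edges4 =
    [Arc 0 0 (0, 5) [(1, Om'), (2, Om'), (3, One4), (4, Om), (0, Om)] [Om', Om', Om', Zero4, Om'],
     Arc 0 2 (3, 11) [(0, One4), (1, One4), (2, One4), (3, One4), (4, One4)] [Zero4, Om', One4, One4, Om'],
     Arc 2 1 (0, 10) [(0, One4), (1, One4), (2, One4), (3, One4), (4, One4)] [Om', One4, One4, One4, One4],
     Arc 1 1 (3, 11) [(3, Om'), (0, One4), (1, Om'), (4, Om), (2, Om)] [Om', One4, Om, Zero4, Om'],
     Arc 0 2 (0, 6) [(0, Om), (4, Om), (3, One4), (2, Om'), (1, Om)] [One4, One4, Om, Om, Zero4],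
     Arc 2 1 (0, 5) [(1, One4), (3, Om), (2, One4), (4, One4), (0, One4)] [One4, Om, Zero4, Om', Om']]"

definition with_reversals :: "(int \<times> int, 'f::field) arc list \<Rightarrow> (int \<times> int, 'f) arc list" where
  "with_reversals as = as @ map reversed as"

text \<open>
  The assumptions of \<open>twisted_lift\<close> about the arcs other than \<open>covering\<close>, in executable form.
\<close>

definition well_formed :: "(int \<times> int, 'f::field) arc list \<Rightarrow> bool" where
  "well_formed as \<longleftrightarrow>
    list_all (\<lambda>a. source a < 3 \<and> target a < 3 \<and>
      0 \<le> fst (shift a) \<and> fst (shift a) \<le> 3 \<and> 0 \<le> snd (shift a) \<and> snd (shift a) \<le> 11 \<and>
      length (direction a) = 5 \<and> length (twist a) = 5 \<and> list_all (\<lambda>ic. fst ic < 5) (twist a) \<and>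
      list_ex (\<lambda>c. c \<noteq> 0) (direction a) \<and>
      list_ex (\<lambda>a'. source a' = target a \<and> target a' = source a \<and>
        semidirect (shift a) (shift a') = (0, 0) \<and> inverse_monomials 5 (twist a) (twist a') \<and>
        direction a' = monomial (twist a) (direction a)) as \<and>
      (source a = target a \<longrightarrow> shift a \<noteq> (0, 0))) as \<and>
    distinct (map (\<lambda>a. (source a, target a, shift a)) as) \<and>
    list_all (\<lambda>p. length (filter (\<lambda>a. source a = p) as) = 4) [0, 1, 2]"

text \<open>
  The ends found by a search are compared with the list of all base vertices one component at a
  time: selecting the ends with a given first component, then those with a given second one, takes
  far fewer comparisons than looking up each triple in the whole list.
\<close>

fun slice :: "'a \<Rightarrow> ('a \<times> 'b) list \<Rightarrow> 'b list" where
  "slice k [] = []"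
| "slice k ((a, b) # zs) = (if a = k then b # slice k zs else slice k zs)"

lemma set_slice: "b \<in> set (slice k zs) \<longleftrightarrow> (k, b) \<in> set zs"
  by (induction k zs rule: slice.induct) auto

fun all_slices :: "('b list \<Rightarrow> bool) \<Rightarrow> 'a list \<Rightarrow> ('a \<times> 'b) list \<Rightarrow> bool" where
  "all_slices P [] zs = True"
| "all_slices P (k # ks) zs = (if P (slice k zs) then all_slices P ks zs else False)"

lemma all_slices_iff: "all_slices P ks zs \<longleftrightarrow> (\<forall>k\<in>set ks. P (slice k zs))"
  by (induction P ks zs rule: all_slices.induct) auto

definition covers :: "(int \<times> int, 'f::field) arc list \<Rightarrow> nat \<Rightarrow> bool" where
  "covers as p \<longleftrightarrow> all_slices (all_slices (\<lambda>es. list_all (List.member es) [0..11]) [0..3]) [0, 1, 2]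
    (walk_ends semidirect as 5 5 p (0, 0) [])"

lemma twisted_lift_base_group:
  fixes as :: "(int \<times> int, 'f::{field,finite}) arc list"
  assumes wf: "well_formed as" and cov: "covers as 0" "covers as 1" "covers as 2"
  shows "twisted_lift base_group as 3 5 4"
proof -
  interpret group base_group by (rule group_base_group)
  show ?thesis
  proof
    show "finite (carrier base_group)" by simp
    fix a assume a: "a \<in> set as"
    show "source a < 3 \<and> target a < 3 \<and> shift a \<in> carrier base_group \<and>
      length (direction a) = 5 \<and> length (twist a) = 5 \<and> (\<forall>(i, c)\<in>set (twist a). i < 5) \<and>
      (\<exists>c\<in>set (direction a). c \<noteq> 0)"
      using wf a unfolding well_formed_def by (simp add: list_all_iff list_ex_iff mem_Times_iff case_prod_beta)
    show "\<exists>a'\<in>set as. source a' = target a \<and> target a' = source a \<and>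
      shift a \<otimes>\<^bsub>base_group\<^esub> shift a' = \<one>\<^bsub>base_group\<^esub> \<and>
      inverse_monomials 5 (twist a) (twist a') \<and> direction a' = monomial (twist a) (direction a)"
      using wf a unfolding well_formed_def by (simp add: list_all_iff list_ex_iff)
    show "source a = target a \<Longrightarrow> shift a \<noteq> \<one>\<^bsub>base_group\<^esub>"
      using wf a unfolding well_formed_def by (simp add: list_all_iff)
  next
    show "distinct (map (\<lambda>a. (source a, target a, shift a)) as)"
      using wf unfolding well_formed_def by blast
    fix p :: nat assume "p < 3"
    then have p: "p \<in> {0, 1, 2}" by auto
    then show "length (filter (\<lambda>a. source a = p) as) = 4"
      using wf unfolding well_formed_def by auto
    have "covers as p" using p cov by auto
    then have "\<forall>q\<in>{0, 1, 2}. \<forall>x\<in>{0..3}. \<forall>e\<in>{0..11}.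
        (q, x, e) \<in> set (walk_ends semidirect as 5 5 p (0, 0) [])"
      by (simp add: covers_def all_slices_iff list_all_iff List.member_iff set_slice del: walk_ends.simps)
    moreover have "{..<3} = {0, 1, 2 :: nat}" by auto
    ultimately show "{..<3} \<times> carrier base_group \<subseteq>
        set (walk_ends (\<otimes>\<^bsub>base_group\<^esub>) as 5 5 p \<one>\<^bsub>base_group\<^esub> [])"
      by auto
  qed
qed

lemma well_formed_edges3: "well_formed (with_reversals edges3)"
  by code_simp

lemma covers_edges3:
  "covers (with_reversals edges3) 0" "covers (with_reversals edges3) 1" "covers (with_reversals edges3) 2"
  by code_simp+

lemma well_formed_edges4: "well_formed (with_reversals edges4)"
  by code_simp

lemma covers_edges4:
  "covers (with_reversals edges4) 0" "covers (with_reversals edges4) 1" "covers (with_reversals edges4) 2"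
  by code_simp+

section \<open>The graphs of degrees 12 and 16\<close>

theorem theorem2p1:
  shows "\<exists>(G3 :: nat pair_pre_digraph) (G4 :: nat pair_pre_digraph).
      (pair_graph G3 \<and> Digraph_Component.connected (with_proj G3) \<and>
        regular G3 12 \<and> card (pverts G3) = 34992 \<and> diam G3 = 5) \<and>
      (pair_graph G4 \<and> Digraph_Component.connected (with_proj G4) \<and>
        regular G4 16 \<and> card (pverts G4) = 147456 \<and> diam G4 = 5)"
proof -
  interpret L3: twisted_lift base_group "with_reversals edges3" 3 5 4
    by (intro twisted_lift_base_group well_formed_edges3 covers_edges3)
  interpret L4: twisted_lift base_group "with_reversals edges4" 3 5 4
    by (intro twisted_lift_base_group well_formed_edges4 covers_edges4)
  have five: "{..<5 :: nat} = {0, 1, 2, 3, 4}" by auto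
  have "\<exists>G :: nat pair_pre_digraph. pair_graph G \<and> Digraph_Component.connected (with_proj G) \<and>
      regular G 12 \<and> card (pverts G) = 34992 \<and> diam G = 5"
    using L3.nat_graph_of_lift by (simp add: card_gf3 five)
  moreover have "\<exists>G :: nat pair_pre_digraph. pair_graph G \<and> Digraph_Component.connected (with_proj G) \<and>
      regular G 16 \<and> card (pverts G) = 147456 \<and> diam G = 5"
    using L4.nat_graph_of_lift by (simp add: card_gf4 five)
  ultimately show ?thesis by blast
qed

end
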